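(* Let $c>0$, $L>0$, $N\ge 2$, let $0=x_0<x_1<\cdots<x_N=L$, put $\Omega_i=(x_{i-1},x_i)$, $h_i=x_i-x_{i-1}$ for $1\le i\le N$, and $h_{\min}=\min_{1\le i\le N}h_i$. Consider the Neumann-Neumann Waveform Relaxation (NNWR) algorithm for the error equations of the one-dimensional wave equation $\partial_{tt}u-c^2\partial_{xx}u=f$ on $(0,L)\times(0,T)$, as defined in the context, with relaxation parameter $\theta=1/4$ and arbitrary initial guesses $w_1^0,\dots,w_{N-1}^0$ on $(0,T)$. Let $k\ge 1$ be an integer. If the time window length $T>0$ satisfies $$\frac{T}{k}\le \frac{2h_{\min}}{c},$$ then the NNWR algorithm converges in $k+1$ iterations, i.e. the error iterates satisfy $u_i^{k+1}\equiv 0$ on $\Omega_i\times(0,T)$ for every $i=1,\dots,N$.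
   Context: NNWR algorithm in 1D, error equations (zero source, zero initial data, zero physical boundary data; the exact solution of the error problem is zero). One is given initial guesses $w_i^0(t)$, $t\in(0,T)$, $1\le i\le N-1$, at the interfaces $x=x_i$, and sets $w_0^k=w_N^k=0$ for all $k\ge 0$. For $k=1,2,\dots$ one performs the following steps. (1) Dirichlet step: for each $i=1,\dots,N$, $u_i^k$ solves $$\partial_{tt}u_i^k-c^2\partial_{xx}u_i^k=0\ \text{ in }\Omega_i\times(0,T),\quad u_i^k(x,0)=0,\ \ \partial_tu_i^k(x,0)=0\ \text{ in }\Omega_i,$$ $$u_i^k(x_{i-1},t)=w_{i-1}^{k-1}(t),\qquad u_i^k(x_i,t)=w_i^{k-1}(t).$$ (2) Neumann step: for each $i=1,\dots,N$, $\varphi_i^k$ solves $$\partial_{tt}\varphi_i^k-c^2\partial_{xx}\varphi_i^k=0\ \text{ in }\Omega_i\times(0,T),\quad \varphi_i^k(x,0)=0,\ \ \partial_t\varphi_i^k(x,0)=0\ \text{ in }\Omega_i,$$ $$-\partial_x\varphi_i^k(x_{i-1},t)=(\partial_xu_{i-1}^k-\partial_xu_i^k)(x_{i-1},t),\qquad \partial_x\varphi_i^k(x_i,t)=(\partial_xu_i^k-\partial_xu_{i+1}^k)(x_i,t),$$ except that at the physical boundary the Neumann condition is replaced by a homogeneous Dirichlet condition: $\varphi_1^k(0,t)=0$ and $\varphi_N^k(L,t)=0$. (3) Update: for $i=1,\dots,N-1$, $$w_i^k(t)=w_i^{k-1}(t)-\theta\left(\varphi_i^k(x_i,t)+\varphi_{i+1}^k(x_i,t)\right),$$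 where $\theta\in(0,1]$ is the relaxation parameter. "Converges in $m$ iterations" means that the $m$-th Dirichlet iterates $u_i^m$ coincide with the exact solution on all subdomains and the whole time window (for the error equations: are identically zero). The initial guesses are understood to be regular enough that the subdomain problems are solvable, the traces used make sense and Laplace transforms in time can be applied (data on $(0,T)$ may be extended to $t>0$). *)

theory Defs
  imports "HOL-Analysis.Analysis"
begin

text \<open>Functions of space and time are curried, \<open>u x t\<close>.  Partial derivatives are taken relative
  to the space interval \<open>A\<close> resp. the time interval \<open>B\<close>: one-sided at an end point belonging to the
  interval, ordinary two-sided derivatives on open intervals.\<close>

definition pdx :: "real set \<Rightarrow> (real \<Rightarrow> real \<Rightarrow> real) \<Rightarrow> real \<Rightarrow> real \<Rightarrow> real" where
  "pdx A u x t = vector_derivative (\<lambda>y. u y t) (at x within A)"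

definition pdt :: "real set \<Rightarrow> (real \<Rightarrow> real \<Rightarrow> real) \<Rightarrow> real \<Rightarrow> real \<Rightarrow> real" where
  "pdt B u x t = vector_derivative (\<lambda>s. u x s) (at t within B)"

definition C1_on :: "real set \<Rightarrow> real set \<Rightarrow> (real \<Rightarrow> real \<Rightarrow> real) \<Rightarrow> bool" where
  "C1_on A B u \<longleftrightarrow>
     (\<forall>x\<in>A. \<forall>t\<in>B. (\<lambda>y. u y t) differentiable (at x within A) \<and>
                    (\<lambda>s. u x s) differentiable (at t within B)) \<and>
     continuous_on (A \<times> B) (\<lambda>(x, t). u x t) \<and>
     continuous_on (A \<times> B) (\<lambda>(x, t). pdx A u x t) \<and>
     continuous_on (A \<times> B) (\<lambda>(x, t). pdt B u x t)"

definition C2_on :: "real set \<Rightarrow> real set \<Rightarrow> (real \<Rightarrow> real \<Rightarrow> real) \<Rightarrow> bool" where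
  "C2_on A B u \<longleftrightarrow> C1_on A B u \<and> C1_on A B (pdx A u) \<and> C1_on A B (pdt B u)"

text \<open>Classical solution on \<open>(a, b) \<times> (0, T)\<close> of the homogeneous wave equation with zero initial
  data.  It is \<open>C\<^sup>2\<close> in the interior, and \<open>C\<^sup>1\<close> up to the lateral boundary and the initial time, so
  that the traces of \<open>u\<close> and of its first derivatives used below exist.  No regularity is imposed
  at \<open>t = T\<close>.\<close>

definition wave_solution ::
    "real \<Rightarrow> real \<Rightarrow> real \<Rightarrow> real \<Rightarrow> (real \<Rightarrow> real \<Rightarrow> real) \<Rightarrow> bool" where
  "wave_solution c T a b u \<longleftrightarrow>
     C1_on {a..b} {0..<T} u \<and>
     C2_on {a<..<b} {0<..<T} u \<and>
     (\<forall>x\<in>{a<..<b}. \<forall>t\<in>{0<..<T}.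
        pdt {0<..<T} (pdt {0<..<T} u) x t - c\<^sup>2 * pdx {a<..<b} (pdx {a<..<b} u) x t = 0) \<and>
     (\<forall>x\<in>{a<..<b}. u x 0 = 0 \<and> pdt {0..<T} u x 0 = 0)"

text \<open>The subdomains are \<open>(X (i - 1), X i)\<close> for \<open>1 \<le> i \<le> N\<close>.  A family of functions on them is
  written \<open>v i x t\<close>; \<open>flux X v i j t\<close> is the trace at \<open>X j\<close>, \<open>j \<in> {i - 1, i}\<close>, of the space
  derivative of \<open>v i\<close>, taken from within the \<open>i\<close>-th subdomain.\<close>

definition flux ::
    "(nat \<Rightarrow> real) \<Rightarrow> (nat \<Rightarrow> real \<Rightarrow> real \<Rightarrow> real) \<Rightarrow> nat \<Rightarrow> nat \<Rightarrow> real \<Rightarrow> real" where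
  "flux X v i j t = pdx {X (i - 1)..X i} (v i) (X j) t"

definition dirichlet_step ::
    "real \<Rightarrow> real \<Rightarrow> nat \<Rightarrow> (nat \<Rightarrow> real) \<Rightarrow>
     (nat \<Rightarrow> real \<Rightarrow> real) \<Rightarrow> (nat \<Rightarrow> real \<Rightarrow> real \<Rightarrow> real) \<Rightarrow> bool" where
  "dirichlet_step c T N X w u \<longleftrightarrow>
     (\<forall>i\<in>{1..N}. wave_solution c T (X (i - 1)) (X i) (u i) \<and>
        (\<forall>t\<in>{0<..<T}. u i (X (i - 1)) t = w (i - 1) t \<and> u i (X i) t = w i t))"

definition neumann_step ::
    "real \<Rightarrow> real \<Rightarrow> nat \<Rightarrow> (nat \<Rightarrow> real) \<Rightarrow>
     (nat \<Rightarrow> real \<Rightarrow> real \<Rightarrow> real) \<Rightarrow> (nat \<Rightarrow> real \<Rightarrow> real \<Rightarrow> real) \<Rightarrow> bool" where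
  "neumann_step c T N X u \<phi> \<longleftrightarrow>
     (\<forall>i\<in>{1..N}. wave_solution c T (X (i - 1)) (X i) (\<phi> i) \<and>
        (\<forall>t\<in>{0<..<T}.
           (if i = 1 then \<phi> i (X 0) t = 0
            else - flux X \<phi> i (i - 1) t = flux X u (i - 1) (i - 1) t - flux X u i (i - 1) t) \<and>
           (if i = N then \<phi> i (X N) t = 0
            else flux X \<phi> i i t = flux X u i i t - flux X u (i + 1) i t)))"

definition update_step ::
    "real \<Rightarrow> real \<Rightarrow> nat \<Rightarrow> (nat \<Rightarrow> real) \<Rightarrow> (nat \<Rightarrow> real \<Rightarrow> real) \<Rightarrow>
     (nat \<Rightarrow> real \<Rightarrow> real \<Rightarrow> real) \<Rightarrow> (nat \<Rightarrow> real \<Rightarrow> real) \<Rightarrow> bool" where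
  "update_step T \<theta> N X w \<phi> w' \<longleftrightarrow>
     (\<forall>i\<in>{1..N - 1}. \<forall>t\<in>{0<..<T}.
        w' i t = w i t - \<theta> * (\<phi> i (X i) t + \<phi> (i + 1) (X i) t))"

text \<open>A run of the NNWR algorithm for the error equations: \<open>w k i\<close>, \<open>u k i\<close>, \<open>\<phi> k i\<close> are the
  iterates with iteration index \<open>k\<close> and interface resp. subdomain index \<open>i\<close>.  The initial guesses
  are \<open>w 0 i\<close> for \<open>1 \<le> i \<le> N - 1\<close>; \<open>u\<close> and \<open>\<phi>\<close> are only meaningful for \<open>k \<ge> 1\<close>.\<close>

definition nnwr_run ::
    "real \<Rightarrow> real \<Rightarrow> real \<Rightarrow> nat \<Rightarrow> (nat \<Rightarrow> real) \<Rightarrow> (nat \<Rightarrow> nat \<Rightarrow> real \<Rightarrow> real) \<Rightarrow>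
     (nat \<Rightarrow> nat \<Rightarrow> real \<Rightarrow> real \<Rightarrow> real) \<Rightarrow> (nat \<Rightarrow> nat \<Rightarrow> real \<Rightarrow> real \<Rightarrow> real) \<Rightarrow> bool" where
  "nnwr_run c T \<theta> N X w u \<phi> \<longleftrightarrow>
     (\<forall>k. \<forall>t\<in>{0<..<T}. w k 0 t = 0 \<and> w k N t = 0) \<and>
     (\<forall>k\<ge>1. dirichlet_step c T N X (w (k - 1)) (u k) \<and>
             neumann_step c T N X (u k) (\<phi> k) \<and>
             update_step T \<theta> N X (w (k - 1)) (\<phi> k) (w k))"

definition converges_in ::
    "nat \<Rightarrow> real \<Rightarrow> nat \<Rightarrow> (nat \<Rightarrow> real) \<Rightarrow> (nat \<Rightarrow> nat \<Rightarrow> real \<Rightarrow> real \<Rightarrow> real) \<Rightarrow> bool" where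
  "converges_in m T N X u \<longleftrightarrow>
     (\<forall>i\<in>{1..N}. \<forall>x\<in>{X (i - 1)<..<X i}. \<forall>t\<in>{0<..<T}. u m i x t = 0)"

definition h_min :: "nat \<Rightarrow> (nat \<Rightarrow> real) \<Rightarrow> real" where
  "h_min N X = Min ((\<lambda>i. X i - X (i - 1)) ` {1..N})"

end

theory Submission
  imports Defs
begin

text \<open>The quantities \<open>\<partial>\<^sub>tu - c \<partial>\<^sub>xu\<close> and \<open>\<partial>\<^sub>tu + c \<partial>\<^sub>xu\<close> are constant along the right- and left-going
  characteristics, so a subdomain acts as a delay line of length \<open>h\<^sub>i/c\<close> between its end points.
  Suppose the interface data vanish up to time \<open>\<tau>\<close>.  Up to time \<open>\<tau> + 2 h_min/c\<close> no signal crosses two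
  subdomains, and on this window the delayed contributions of neighbouring interfaces cancel in
  \<open>\<partial>\<^sub>t(\<phi>\<^sub>i + \<phi>\<^sub>i\<^sub>+\<^sub>1)\<close> at \<open>x\<^sub>i\<close>, which leaves \<open>4 \<partial>\<^sub>tw\<^sub>i\<close>.  With \<open>\<theta> = 1/4\<close> the updated data
  vanish there, so each iteration gains \<open>2 h_min/c\<close>.\<close>

section \<open>Calculus: mixed partial derivatives and derivatives along lines\<close>

text \<open>The mean value theorem is applied in \<open>x\<close> to the increment of
  \<open>f\<close> between \<open>t\<close> and \<open>t+h\<close>, then in \<open>t\<close> to
  \<open>fx y\<close>. With the variables exchanged it expresses the same second difference through
  the other mixed derivative.\<close>

lemma mixed_difference_MVT:
  fixes f :: "real \<Rightarrow> real \<Rightarrow> real"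
  assumes h: "h > 0"
    and fx: "\<And>y s. y \<in> {x..x+h} \<Longrightarrow> s \<in> {t..t+h} \<Longrightarrow>
               ((\<lambda>y. f y s) has_real_derivative fx y s) (at y)"
    and fxt: "\<And>y s. y \<in> {x..x+h} \<Longrightarrow> s \<in> {t..t+h} \<Longrightarrow>
               ((\<lambda>s. fx y s) has_real_derivative fxt y s) (at s)"
  obtains y s where "y \<in> {x<..<x+h}" "s \<in> {t<..<t+h}"
    "f (x+h) (t+h) - f (x+h) t - f x (t+h) + f x t = h * h * fxt y s"
proof -
  have "\<exists>y. x < y \<and> y < x + h \<and>
      (f (x+h) (t+h) - f (x+h) t) - (f x (t+h) - f x t) = (x + h - x) * (fx y (t+h) - fx y t)"
    using h by (intro MVT2) (auto intro!: DERIV_diff fx)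
  then obtain y where y: "x < y" "y < x + h"
    "(f (x+h) (t+h) - f (x+h) t) - (f x (t+h) - f x t) = (x + h - x) * (fx y (t+h) - fx y t)"
    by blast
  have "\<exists>s. t < s \<and> s < t + h \<and> fx y (t+h) - fx y t = (t + h - t) * fxt y s"
    using h y by (intro MVT2) (auto intro!: fxt)
  then obtain s where "t < s" "s < t + h" "fx y (t+h) - fx y t = (t + h - t) * fxt y s"
    by blast
  with y that[of y s] show ?thesis by (simp add: algebra_simps)
qed

text \<open>Clairaut's theorem: the second difference over a small square equals
  \<open>h * h\<close> times either mixed derivative at some point of the square, and continuity
  brings both values close to those at \<open>(x, t)\<close>.\<close>

lemma mixed_partials_eq:
  fixes f :: "real \<Rightarrow> real \<Rightarrow> real"
  assumes op: "open A" "open B" and xt: "x \<in> A" "t \<in> B"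
    and fx: "\<And>y s. y \<in> A \<Longrightarrow> s \<in> B \<Longrightarrow> ((\<lambda>y. f y s) has_real_derivative fx y s) (at y)"
    and ft: "\<And>y s. y \<in> A \<Longrightarrow> s \<in> B \<Longrightarrow> ((\<lambda>s. f y s) has_real_derivative ft y s) (at s)"
    and fxt: "\<And>y s. y \<in> A \<Longrightarrow> s \<in> B \<Longrightarrow> ((\<lambda>s. fx y s) has_real_derivative fxt y s) (at s)"
    and ftx: "\<And>y s. y \<in> A \<Longrightarrow> s \<in> B \<Longrightarrow> ((\<lambda>y. ft y s) has_real_derivative ftx y s) (at y)"
    and cxt: "continuous_on (A \<times> B) (\<lambda>(y, s). fxt y s)"
    and ctx: "continuous_on (A \<times> B) (\<lambda>(y, s). ftx y s)"
  shows "fxt x t = ftx x t"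
proof -
  have "dist (fxt x t) (ftx x t) < e" if e: "e > 0" for e
  proof -
    have opp: "open (A \<times> B)" and mem: "(x, t) \<in> A \<times> B"
      using op xt by (auto intro: open_Times)
    obtain d0 where d0: "d0 > 0" "ball (x, t) d0 \<subseteq> A \<times> B"
      using opp mem open_contains_ball by blast
    have "continuous (at (x, t)) (\<lambda>(y, s). fxt y s)" "continuous (at (x, t)) (\<lambda>(y, s). ftx y s)"
      using cxt ctx opp mem by (auto simp: continuous_on_eq_continuous_at)
    with e obtain d1 d2 where d1: "d1 > 0"
        "\<And>p. dist p (x, t) < d1 \<Longrightarrow> dist (case p of (y, s) \<Rightarrow> fxt y s) (fxt x t) < e/2"
      and d2: "d2 > 0"
        "\<And>p. dist p (x, t) < d2 \<Longrightarrow> dist (case p of (y, s) \<Rightarrow> ftx y s) (ftx x t) < e/2"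
      unfolding continuous_at_eps_delta
      by (metis (no_types, lifting) case_prod_conv half_gt_zero)
    \<comment> \<open>Points of the square of side \<open>h\<close> lie within \<open>2 * h\<close>
      of \<open>(x, t)\<close>; the divisor 3 keeps this strictly below all three radii.\<close>
    define h where "h = min d0 (min d1 d2) / 3"
    have h: "h > 0" using d0 d1 d2 by (simp add: h_def)
    have near: "dist (y, s) (x, t) < d0 \<and> dist (y, s) (x, t) < d1 \<and> dist (y, s) (x, t) < d2"
      if "y \<in> {x..x+h}" "s \<in> {t..t+h}" for y s
    proof -
      have "dist (y, s) (x, t) \<le> \<bar>y - x\<bar> + \<bar>s - t\<bar>"
        by (simp add: dist_Pair_Pair dist_real_def sqrt_sum_squares_le_sum_abs)
      also have "\<dots> \<le> 2 * h" using that by auto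
      also have "\<dots> < min d0 (min d1 d2)" using d0(1) d1(1) d2(1) by (simp add: h_def min_def)
      finally show ?thesis by simp
    qed
    have inside: "y \<in> A" "s \<in> B" if "y \<in> {x..x+h}" "s \<in> {t..t+h}" for y s
      using near[OF that] d0(2) by (auto simp: subset_iff dist_commute)
    have "\<exists>y s. y \<in> {x<..<x+h} \<and> s \<in> {t<..<t+h} \<and>
        f (x+h) (t+h) - f (x+h) t - f x (t+h) + f x t = h * h * fxt y s"
      using mixed_difference_MVT[of h x t f fx fxt] h inside fx fxt by metis
    then obtain y s where ys: "y \<in> {x<..<x+h}" "s \<in> {t<..<t+h}"
        "f (x+h) (t+h) - f (x+h) t - f x (t+h) + f x t = h * h * fxt y s"
      by blast
    have "\<exists>s y. s \<in> {t<..<t+h} \<and> y \<in> {x<..<x+h} \<and>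
        f (x+h) (t+h) - f x (t+h) - f (x+h) t + f x t = h * h * ftx y s"
      using mixed_difference_MVT[of h t x "\<lambda>s y. f y s" "\<lambda>s y. ft y s" "\<lambda>s y. ftx y s"]
        h inside ft ftx by metis
    then obtain y' s' where ys': "y' \<in> {x<..<x+h}" "s' \<in> {t<..<t+h}"
        "f (x+h) (t+h) - f x (t+h) - f (x+h) t + f x t = h * h * ftx y' s'"
      by blast
    have "h * h * fxt y s = h * h * ftx y' s'" using ys(3) ys'(3) by linarith
    with h have "fxt y s = ftx y' s'" by simp
    moreover have "dist (fxt y s) (fxt x t) < e/2"
      using d1(2)[of "(y, s)"] near[of y s] ys by auto
    moreover have "dist (ftx y' s') (ftx x t) < e/2"
      using d2(2)[of "(y', s')"] near[of y' s'] ys' by auto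
    ultimately show ?thesis by (simp add: dist_real_def abs_if split: if_splits)
  qed
  then show ?thesis by (metis dist_pos_lt less_irrefl)
qed

lemma directional_derivative:
  fixes v :: "real \<Rightarrow> real \<Rightarrow> real"
  assumes op: "open A" "open B" "convex B" and xt: "x + c * r \<in> A" "t + r \<in> B"
    and vx: "\<And>y s. y \<in> A \<Longrightarrow> s \<in> B \<Longrightarrow> ((\<lambda>y. v y s) has_real_derivative vx y s) (at y)"
    and vt: "\<And>y s. y \<in> A \<Longrightarrow> s \<in> B \<Longrightarrow> ((\<lambda>s. v y s) has_real_derivative vt y s) (at s)"
    and ct: "continuous_on (A \<times> B) (\<lambda>(y, s). vt y s)"
  shows "((\<lambda>r. v (x + c * r) (t + r)) has_real_derivative
           c * vx (x + c * r) (t + r) + vt (x + c * r) (t + r)) (at r)"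
proof -
  let ?y = "x + c * r" and ?s = "t + r"
  \<comment> \<open>\<open>has_derivative_partialsI\<close> wants the second partial derivative as a
    continuous family of bounded linear maps, hence the \<open>blinfun_scaleR_left\<close> encoding
    of \<open>vt\<close>.\<close>
  have cont: "continuous (at (?y, ?s) within A \<times> B) (\<lambda>(y, s). blinfun_scaleR_left (vt y s))"
    using continuous_on_eq_continuous_within[THEN iffD1, OF ct] xt
    unfolding case_prod_unfold
    by (auto intro!: bounded_linear.continuous[OF bounded_linear_blinfun_scaleR_left])
  have "((\<lambda>(y, s). v y s) has_derivative
      (\<lambda>(ty, ts). ty * vx ?y ?s + blinfun_scaleR_left (vt ?y ?s) ts)) (at (?y, ?s) within A \<times> B)"
    using vx vt op xt cont
    by (intro has_derivative_partialsI)
       (auto simp: has_field_derivative_def mult_commute_abs intro: has_derivative_at_withinI)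
  then have "((\<lambda>(y, s). v y s) has_derivative
      (\<lambda>(ty, ts). ty * vx ?y ?s + ts * vt ?y ?s)) (at (?y, ?s))"
    using op xt by (subst (asm) at_within_open) (auto intro: open_Times)
  moreover have "((\<lambda>r. (x + c * r, t + r)) has_derivative (\<lambda>d. (c * d, d))) (at r)"
    by (auto intro!: derivative_eq_intros)
  ultimately have "((\<lambda>r. (\<lambda>(y, s). v y s) (x + c * r, t + r)) has_derivative
      (\<lambda>d. (\<lambda>(ty, ts). ty * vx ?y ?s + ts * vt ?y ?s) (c * d, d))) (at r)"
    by (rule has_derivative_compose[rotated])
  then show ?thesis
    by (auto elim!: has_derivative_imp_has_field_derivative simp: algebra_simps)
qed

section \<open>Riemann invariants and their transport along characteristics\<close>

text \<open>The sign of \<open>c\<close> selects the right-going (\<open>c > 0\<close>) or left-going (\<open>c < 0\<close>) invariant; extension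
  by zero to \<open>t < 0\<close> lets the delay relations hold for all \<open>t < T\<close>.\<close>

definition riemann_invariant ::
    "real \<Rightarrow> real \<Rightarrow> real \<Rightarrow> real \<Rightarrow> (real \<Rightarrow> real \<Rightarrow> real) \<Rightarrow> real \<Rightarrow> real \<Rightarrow> real" where
  "riemann_invariant c T a b u x t =
     (if t < 0 then 0 else pdt {0..<T} u x t - c * pdx {a..b} u x t)"

lemma C1_on_DERIV:
  assumes "C1_on A B f" "x \<in> A" "t \<in> B"
  shows "((\<lambda>y. f y t) has_real_derivative pdx A f x t) (at x within A)"
    and "((\<lambda>s. f x s) has_real_derivative pdt B f x t) (at t within B)"
  using assms
  by (simp_all add: C1_on_def pdx_def pdt_def vector_derivative_works
      has_real_derivative_iff_has_vector_derivative)

lemma C1_on_open_DERIV: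
  assumes "C1_on A B f" "open A" "open B" "x \<in> A" "t \<in> B"
  shows "((\<lambda>y. f y t) has_real_derivative pdx A f x t) (at x)"
    and "((\<lambda>s. f x s) has_real_derivative pdt B f x t) (at t)"
  using C1_on_DERIV[OF assms(1,4,5)] assms
  by (simp_all add: at_within_open_NO_MATCH)

text \<open>The invariant is built from derivatives relative to the closed space interval and
  \<open>{0..<T}\<close>, whereas the wave equation is stated on open intervals; at interior points
  both are two-sided derivatives.\<close>

lemma riemann_invariant_interior:
  assumes "x \<in> {a<..<b}" "t \<in> {0<..<T}"
  shows "riemann_invariant c T a b u x t = pdt {0<..<T} u x t - c * pdx {a<..<b} u x t"
proof -
  have "at t within {0..<T} = at t" "at x within {a..b} = at x"
    using assms by (auto intro!: at_within_interior)
  moreover have "at t within {0<..<T} = at t" "at x within {a<..<b} = at x"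
    using assms by (auto intro!: at_within_open)
  ultimately show ?thesis using assms by (simp add: riemann_invariant_def pdt_def pdx_def)
qed

text \<open>Applying d/dt + c d/dx to u_t - c u_x gives u_tt - c^2 u_xx, since the mixed derivatives
  cancel. Only the square of the speed enters, so \<open>c\<close> may have either sign.\<close>

lemma wave_solution_characteristic_derivative:
  assumes u: "wave_solution c' T a b u" and c: "c\<^sup>2 = c'\<^sup>2"
    and xt: "x + c * r \<in> {a<..<b}" "t + r \<in> {0<..<T}"
  shows "((\<lambda>r. riemann_invariant c T a b u (x + c * r) (t + r)) has_real_derivative 0) (at r)"
proof -
  let ?A = "{a<..<b}" and ?B = "{0<..<T}"
  let ?ux = "pdx ?A u" and ?ut = "pdt ?B u"
  have C: "C1_on ?A ?B u" "C1_on ?A ?B ?ux" "C1_on ?A ?B ?ut"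
    using u unfolding wave_solution_def C2_on_def by blast+
  have wave: "pdt ?B ?ut y s = c\<^sup>2 * pdx ?A ?ux y s" if "y \<in> ?A" "s \<in> ?B" for y s
  proof -
    have "pdt ?B ?ut y s - c'\<^sup>2 * pdx ?A ?ux y s = 0"
      using u that unfolding wave_solution_def by blast
    then show ?thesis by (simp add: c)
  qed
  note D = C1_on_open_DERIV[OF _ open_greaterThanLessThan open_greaterThanLessThan]
  have cont: "continuous_on (?A \<times> ?B) (\<lambda>(y, s). pdt ?B ?ux y s)"
      "continuous_on (?A \<times> ?B) (\<lambda>(y, s). pdx ?A ?ut y s)"
      "continuous_on (?A \<times> ?B) (\<lambda>(y, s). pdt ?B ?ut y s)"
    using C(2,3) by (simp_all add: C1_on_def)
  have mixed: "pdt ?B ?ux y s = pdx ?A ?ut y s" if "y \<in> ?A" "s \<in> ?B" for y s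
    by (rule mixed_partials_eq[OF open_greaterThanLessThan open_greaterThanLessThan that
          D(1)[OF C(1)] D(2)[OF C(1)] D(2)[OF C(2)] D(1)[OF C(3)] cont(1,2)])
  have ct: "continuous_on (?A \<times> ?B) (\<lambda>(y, s). pdt ?B ?ut y s - c * pdt ?B ?ux y s)"
    using cont(1,3) unfolding case_prod_unfold by (intro continuous_intros)
  have "((\<lambda>r. (\<lambda>y s. ?ut y s - c * ?ux y s) (x + c * r) (t + r)) has_real_derivative
      c * (pdx ?A ?ut (x + c * r) (t + r) - c * pdx ?A ?ux (x + c * r) (t + r)) +
      (pdt ?B ?ut (x + c * r) (t + r) - c * pdt ?B ?ux (x + c * r) (t + r))) (at r)"
    by (rule directional_derivative[where A = ?A and B = ?B])
       (use xt ct in \<open>simp_all add: D(1)[OF C(2)] D(1)[OF C(3)] D(2)[OF C(2)] D(2)[OF C(3)]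
          DERIV_diff DERIV_cmult\<close>)
  then have "((\<lambda>r. ?ut (x + c * r) (t + r) - c * ?ux (x + c * r) (t + r))
      has_real_derivative 0) (at r)"
    using xt by (simp add: wave mixed power2_eq_square algebra_simps)
  moreover have "\<forall>\<^sub>F r in nhds r. x + c * r \<in> ?A \<and> t + r \<in> ?B"
  proof (rule eventually_conj)
    have "continuous_on UNIV (\<lambda>r. x + c * r)" "continuous_on UNIV (\<lambda>r. t + r)"
      by (auto intro!: continuous_intros)
    then have "open ((\<lambda>r. x + c * r) -` ?A)" "open ((\<lambda>r. t + r) -` ?B)"
      by (auto intro!: open_vimage)
    then show "\<forall>\<^sub>F r in nhds r. x + c * r \<in> ?A" "\<forall>\<^sub>F r in nhds r. t + r \<in> ?B"
      using xt by (auto simp: eventually_nhds)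
  qed
  then have "\<forall>\<^sub>F r in nhds r. riemann_invariant c T a b u (x + c * r) (t + r) =
      ?ut (x + c * r) (t + r) - c * ?ux (x + c * r) (t + r)"
    by eventually_elim (rule riemann_invariant_interior; simp)
  ultimately show ?thesis by (subst DERIV_cong_ev[OF refl _ refl]) auto
qed

text \<open>Initial data are prescribed on the open interval only. Continuity of \<open>u\<close>
  and of its time derivative carries them to the end points, where the interface traces are
  taken.\<close>

lemma wave_solution_initial:
  assumes u: "wave_solution c' T a b u" and ab: "a < b" and T: "0 < T" and x: "x \<in> {a..b}"
  shows "u x 0 = 0" "riemann_invariant c T a b u x 0 = 0"
proof -
  have C1: "C1_on {a..b} {0..<T} u"
    and init: "\<And>x. x \<in> {a<..<b} \<Longrightarrow> u x 0 = 0 \<and> pdt {0..<T} u x 0 = 0"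
    using u unfolding wave_solution_def by blast+
  have zero: "f y 0 = 0"
    if f: "continuous_on ({a..b} \<times> {0..<T}) (\<lambda>(x, t). f x t)"
      and f0: "\<And>x. x \<in> {a<..<b} \<Longrightarrow> f x 0 = 0" and y: "y \<in> {a..b}"
    for y and f :: "real \<Rightarrow> real \<Rightarrow> real"
  proof -
    have "continuous_on {a..b} (\<lambda>x. case (x, 0) of (x, t) \<Rightarrow> f x t)"
      by (rule continuous_on_compose2[OF f]) (use T in \<open>auto intro!: continuous_intros\<close>)
    then show ?thesis
      using continuous_constant_on_closure[of "{a<..<b}" "\<lambda>x. f x 0" 0 y] f0 y
      by (simp only: closure_greaterThanLessThan[OF ab] prod.case)
  qed
  have u0: "u x 0 = 0" and ut0: "pdt {0..<T} u x 0 = 0" if "x \<in> {a..b}" for x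
    using zero[of u x] zero[of "pdt {0..<T} u" x] C1 init that by (simp_all add: C1_on_def)
  show "u x 0 = 0" using u0 x .
  have "((\<lambda>y. u y 0) has_vector_derivative 0) (at x within {a..b})"
    by (rule has_vector_derivative_transform[OF x _ has_vector_derivative_const[of 0]])
       (simp add: u0)
  then have "pdx {a..b} u x 0 = 0"
    unfolding pdx_def using ab x by (intro vector_derivative_within_closed_interval) auto
  with ut0[OF x] show "riemann_invariant c T a b u x 0 = 0"
    by (simp add: riemann_invariant_def)
qed

lemma riemann_invariant_continuous:
  assumes "wave_solution c' T a b u"
  shows "continuous_on ({a..b} \<times> {0..<T}) (\<lambda>(x, t). riemann_invariant c T a b u x t)"
proof -
  have "C1_on {a..b} {0..<T} u" using assms unfolding wave_solution_def by blast
  then have "continuous_on ({a..b} \<times> {0..<T}) (\<lambda>(x, t). pdt {0..<T} u x t - c * pdx {a..b} u x t)"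
    unfolding C1_on_def case_prod_unfold by (intro continuous_intros) auto
  then show ?thesis
    by (rule continuous_on_eq) (auto simp: riemann_invariant_def)
qed

lemma riemann_invariant_segment:
  assumes u: "wave_solution c' T a b u" and c: "c\<^sup>2 = c'\<^sup>2" "c \<noteq> 0"
    and r: "0 \<le> r" and t: "0 \<le> t" "t + r < T" and x: "x \<in> {a..b}" "x + c * r \<in> {a..b}"
  shows "riemann_invariant c T a b u (x + c * r) (t + r) = riemann_invariant c T a b u x t"
proof (cases "r = 0")
  case False
  then have r: "0 < r" using r by simp
  have seg: "x + c * s \<in> {a..b}" if "s \<in> {0..r}" for s
  proof (cases "c > 0")
    case True
    then have "0 \<le> c * s" "c * s \<le> c * r" using that by auto
    then show ?thesis using x by auto
  next
    case False
    then have "c * s \<le> 0" "c * r \<le> c * s"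
      using that by (auto simp: mult_le_0_iff mult_left_mono_neg)
    then show ?thesis using x by auto
  qed
  have seg': "x + c * s \<in> {a<..<b}" if "0 < s" "s < r" for s
  proof (cases "c > 0")
    case True
    then have "0 < c * s" "c * s < c * r" using that by auto
    then show ?thesis using x by auto
  next
    case False
    then have "c * s < 0" "c * r < c * s"
      using that c by (auto simp: mult_less_0_iff)
    then show ?thesis using x by auto
  qed
  have "riemann_invariant c T a b u (x + c * r) (t + r) =
      riemann_invariant c T a b u (x + c * 0) (t + 0)"
  proof (rule DERIV_isconst_end[OF r])
    have "continuous_on {0..r}
        (\<lambda>s. case (x + c * s, t + s) of (x, t) \<Rightarrow> riemann_invariant c T a b u x t)"
      by (rule continuous_on_compose2[OF riemann_invariant_continuous[OF u]])
         (use seg t in \<open>auto intro!: continuous_intros\<close>)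
    then show "continuous_on {0..r} (\<lambda>s. riemann_invariant c T a b u (x + c * s) (t + s))"
      by simp
  next
    fix s assume "0 < s" "s < r"
    then show "((\<lambda>s. riemann_invariant c T a b u (x + c * s) (t + s)) has_real_derivative 0) (at s)"
      using seg' t by (intro wave_solution_characteristic_derivative[OF u c(1)]) auto
  qed
  then show ?thesis by simp
qed simp

lemma riemann_invariant_transport:
  assumes u: "wave_solution c' T a b u" and c: "c\<^sup>2 = c'\<^sup>2" "c \<noteq> 0" and ab: "a < b"
    and r: "0 \<le> r" and t: "t < T" and x: "x \<in> {a..b}" "x + c * r \<in> {a..b}"
  shows "riemann_invariant c T a b u (x + c * r) t = riemann_invariant c T a b u x (t - r)"
proof -
  consider "t < 0" | "0 \<le> t" "t < r" | "r \<le> t" by linarith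
  then show ?thesis
  proof cases
    case 1
    with r show ?thesis by (simp add: riemann_invariant_def)
  next
    case 2
    \<comment> \<open>Followed backwards, the characteristic reaches the initial line before time
      \<open>t - r\<close>. Its foot lies between \<open>x\<close> and \<open>x + c * r\<close>, and
      the invariant is zero there.\<close>
    have "x + c * (r - t) \<in> {a..b}"
    proof (cases "c > 0")
      case True
      then have "0 \<le> c * (r - t)" "c * (r - t) \<le> c * r" using 2 by auto
      then show ?thesis using x by auto
    next
      case False
      then have "c * (r - t) \<le> 0" "c * r \<le> c * (r - t)"
        using 2 by (auto simp: mult_le_0_iff mult_left_mono_neg)
      then show ?thesis using x by auto
    qed
    then have "riemann_invariant c T a b u (x + c * (r - t) + c * t) (0 + t) = 0"
      using riemann_invariant_segment[OF u c, of t 0 "x + c * (r - t)"]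
        wave_solution_initial(2)[OF u ab] 2 t x by (simp add: algebra_simps)
    with 2 show ?thesis by (simp add: algebra_simps riemann_invariant_def)
  next
    case 3
    then show ?thesis
      using riemann_invariant_segment[OF u c r, of "t - r" x] t x by simp
  qed
qed

text \<open>Differences of the two invariants encode Neumann data, while their sums encode time
  derivatives of Dirichlet data.\<close>

lemma riemann_invariant_diff:
  assumes "0 \<le> t"
  shows "riemann_invariant (- c) T a b u x t - riemann_invariant c T a b u x t =
           2 * c * pdx {a..b} u x t"
  using assms by (simp add: riemann_invariant_def)

lemma wave_solution_time_DERIV:
  assumes u: "wave_solution c' T a b u" and x: "x \<in> {a..b}" and t: "t \<in> {0<..<T}"
  shows "((\<lambda>s. u x s) has_real_derivative
     (riemann_invariant c T a b u x t + riemann_invariant (- c) T a b u x t) / 2) (at t)"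
proof -
  have "at t within {0..<T} = at t"
    using t by (auto intro!: at_within_interior)
  moreover have "C1_on {a..b} {0..<T} u" using u unfolding wave_solution_def by blast
  ultimately have "((\<lambda>s. u x s) has_real_derivative pdt {0..<T} u x t) (at t)"
    using C1_on_DERIV(2)[of "{a..b}" "{0..<T}" u x t] x t by simp
  with t show ?thesis by (simp add: riemann_invariant_def)
qed

lemma wave_solution_time_continuous:
  assumes u: "wave_solution c T a b u" and x: "x \<in> {a..b}"
  shows "continuous_on {0..<T} (\<lambda>s. u x s)"
proof -
  have "continuous_on ({a..b} \<times> {0..<T}) (\<lambda>(x, t). u x t)"
    using u unfolding wave_solution_def C1_on_def by blast
  then have "continuous_on {0..<T} (\<lambda>s. case (x, s) of (x, t) \<Rightarrow> u x t)"
    by (rule continuous_on_compose2) (use x in \<open>auto intro!: continuous_intros\<close>)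
  then show ?thesis by simp
qed

lemma riemann_invariant_traverse:
  assumes u: "wave_solution c T a b u" and c: "c > 0" and ab: "a < b" and t: "t < T"
  shows "riemann_invariant c T a b u b t = riemann_invariant c T a b u a (t - (b - a) / c)"
    and "riemann_invariant (- c) T a b u a t = riemann_invariant (- c) T a b u b (t - (b - a) / c)"
  using riemann_invariant_transport[OF u refl, of "(b - a) / c" t a]
    riemann_invariant_transport[OF u, of "- c" "(b - a) / c" t b] assms by auto

section \<open>Reflections and the network of interface traces\<close>

text \<open>Each wave leaving an end point has the size of the wave arriving there, which left the
  other end point a time \<open>h\<close> earlier; induction over time bands of length
  \<open>h\<close> leads back to negative times. Absolute values cover Dirichlet (r = -s) and
  Neumann (r = s) reflection together.\<close>

lemma reflecting_traces_zero:
  fixes rl rr sl sr :: "real \<Rightarrow> real"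
  assumes h: "h > 0"
    and tr: "\<And>t. t < \<tau> \<Longrightarrow> rr t = rl (t - h)" "\<And>t. t < \<tau> \<Longrightarrow> sl t = sr (t - h)"
    and rf: "\<And>t. t < \<tau> \<Longrightarrow> \<bar>rl t\<bar> = \<bar>sl t\<bar>" "\<And>t. t < \<tau> \<Longrightarrow> \<bar>rr t\<bar> = \<bar>sr t\<bar>"
    and neg: "\<And>t. t < 0 \<Longrightarrow> rl t = 0" "\<And>t. t < 0 \<Longrightarrow> sr t = 0"
    and t: "t < \<tau>"
  shows "rl t = 0" "rr t = 0" "sl t = 0" "sr t = 0"
proof -
  have "\<forall>t. t < \<tau> \<longrightarrow> t < real n * h \<longrightarrow> rl t = 0 \<and> sr t = 0" for n
  proof (induction n)
    case 0
    with neg show ?case by auto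
  next
    case (Suc n)
    show ?case
    proof (intro allI impI)
      fix t assume t: "t < \<tau>" "t < real (Suc n) * h"
      then have "t - h < \<tau>" "t - h < real n * h" using h by (auto simp: algebra_simps)
      with Suc have "rl (t - h) = 0" "sr (t - h) = 0" by auto
      with tr rf t show "rl t = 0 \<and> sr t = 0" by (metis abs_0 abs_eq_0)
    qed
  qed
  moreover obtain n where "t < real n * h"
    using h reals_Archimedean3 by blast
  ultimately show "rl t = 0" "sr t = 0" using t by auto
  with rf t show "rr t = 0" "sl t = 0" by (metis abs_0 abs_eq_0)+
qed

text \<open>Here \<open>r\<close>, \<open>s\<close> are the right- and left-going characteristic quantities of the Dirichlet iterates
  and \<open>p\<close>, \<open>q\<close> those of the Neumann iterates; \<open>r i j\<close> is the trace at \<open>X j\<close> from the \<open>i\<close>-th subdomain.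
  Before a signal can cross two subdomains, the wave arriving at an interface in the Neumann step is
  twice the one arriving in the Dirichlet step, and all couplings between interfaces cancel.\<close>

lemma characteristic_network_step:
  fixes r s p q :: "nat \<Rightarrow> nat \<Rightarrow> real \<Rightarrow> real" and W :: "nat \<Rightarrow> real \<Rightarrow> real" and h :: "nat \<Rightarrow> real"
  defines "g \<equiv> \<lambda>i t. (s i i t - r i i t) - (s (Suc i) i t - r (Suc i) i t)"
  assumes \<delta>: "\<delta> > 0" "\<And>i. i \<in> {1..N} \<Longrightarrow> \<delta> \<le> h i"
    and neg: "\<And>i j t. t < 0 \<Longrightarrow> r i j t = 0 \<and> s i j t = 0 \<and> p i j t = 0 \<and> q i j t = 0"
    and tr: "\<And>i t. i \<in> {1..N} \<Longrightarrow> t < T \<Longrightarrow> r i i t = r i (i - 1) (t - h i)"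
      "\<And>i t. i \<in> {1..N} \<Longrightarrow> t < T \<Longrightarrow> s i (i - 1) t = s i i (t - h i)"
      "\<And>i t. i \<in> {1..N} \<Longrightarrow> t < T \<Longrightarrow> p i i t = p i (i - 1) (t - h i)"
      "\<And>i t. i \<in> {1..N} \<Longrightarrow> t < T \<Longrightarrow> q i (i - 1) t = q i i (t - h i)"
    and dir: "\<And>i t. i \<in> {1..N} \<Longrightarrow> t < T \<Longrightarrow> r i (i - 1) t + s i (i - 1) t = 2 * W (i - 1) t"
      "\<And>i t. i \<in> {1..N} \<Longrightarrow> t < T \<Longrightarrow> r i i t + s i i t = 2 * W i t"
    and neu: "\<And>i t. i \<in> {1..<N} \<Longrightarrow> t < T \<Longrightarrow> q i i t - p i i t = g i t"
      "\<And>i t. i \<in> {1..<N} \<Longrightarrow> t < T \<Longrightarrow> p (Suc i) i t - q (Suc i) i t = g i t"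
    and bd: "\<And>t. t < T \<Longrightarrow> p 1 0 t + q 1 0 t = 0" "\<And>t. t < T \<Longrightarrow> p N N t + q N N t = 0"
      "\<And>t. t < T \<Longrightarrow> W 0 t = 0" "\<And>t. t < T \<Longrightarrow> W N t = 0"
    and W: "\<And>i t. i \<le> N \<Longrightarrow> t < T \<Longrightarrow> t < \<tau> \<Longrightarrow> W i t = 0"
    and i: "i \<in> {1..<N}" and t: "t < T" "t < \<tau> + 2 * \<delta>"
  shows "(p i i t + q i i t) + (p (Suc i) i t + q (Suc i) i t) = 8 * W i t"
proof -
  have u0: "r j (j - 1) t = 0 \<and> r j j t = 0 \<and> s j (j - 1) t = 0 \<and> s j j t = 0"
    if j: "j \<in> {1..N}" and t: "t < min T \<tau>" for j t
  proof -
    have "\<bar>r j (j - 1) t\<bar> = \<bar>s j (j - 1) t\<bar>" "\<bar>r j j t\<bar> = \<bar>s j j t\<bar>" if "t < min T \<tau>" for t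
      using dir[OF j, of t] W[of "j - 1" t] W[of j t] j that by auto
    then show ?thesis
      using reflecting_traces_zero[of "h j" "min T \<tau>" "r j j" "r j (j - 1)" "s j (j - 1)" "s j j" t]
        \<delta>(1) \<delta>(2)[OF j] tr(1,2)[OF j] neg t by auto
  qed
  have g0: "g j t = 0" if "j \<in> {1..<N}" "t < min T \<tau>" for j t
    using u0[of j t] u0[of "Suc j" t] that by (auto simp: g_def)
  \<comment> \<open>At a physical end the Dirichlet condition gives p = -q; at an interface the
    vanishing jump \<open>g\<close> gives p = q. Both are reflections without loss.\<close>
  have \<phi>0: "p j (j - 1) t = 0 \<and> p j j t = 0 \<and> q j (j - 1) t = 0 \<and> q j j t = 0"
    if j: "j \<in> {1..N}" and t: "t < min T \<tau>" for j t
  proof -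
    have "\<bar>p j (j - 1) t\<bar> = \<bar>q j (j - 1) t\<bar>" if "t < min T \<tau>" for t
    proof (cases "j = 1")
      case True
      with bd(1)[of t] that show ?thesis by auto
    next
      case False
      with j obtain m where "j = Suc m" "m \<in> {1..<N}" by (cases j) auto
      with neu(2)[of m t] g0[of m t] that show ?thesis by auto
    qed
    moreover have "\<bar>p j j t\<bar> = \<bar>q j j t\<bar>" if "t < min T \<tau>" for t
    proof (cases "j = N")
      case True
      with bd(2)[of t] that show ?thesis by auto
    next
      case False
      with j neu(1)[of j t] g0[of j t] that show ?thesis by auto
    qed
    ultimately show ?thesis
      using reflecting_traces_zero[of "h j" "min T \<tau>" "p j j" "p j (j - 1)" "q j (j - 1)" "q j j" t]
        \<delta>(1) \<delta>(2)[OF j] tr(3,4)[OF j] neg t by auto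
  qed
  \<comment> \<open>Two crossings earlier everything was at rest, so the wave sent out at time
    \<open>t - h j\<close> consists of the Dirichlet data alone.\<close>
  have in1: "r j j t = 2 * W (j - 1) (t - h j)" "s j (j - 1) t = 2 * W j (t - h j)"
    if j: "j \<in> {1..N}" and t: "t < T" "t < \<tau> + 2 * \<delta>" for j t
  proof -
    have t': "t - h j < T" "t - h j - h j < min T \<tau>" using t \<delta>(1) \<delta>(2)[OF j] by auto
    have "s j (j - 1) (t - h j) = 0" "r j j (t - h j) = 0"
      using tr(1,2)[OF j t'(1)] u0[OF j t'(2)] by simp_all
    with dir[OF j t'(1)] tr(1,2)[OF j t(1)]
    show "r j j t = 2 * W (j - 1) (t - h j)" "s j (j - 1) t = 2 * W j (t - h j)" by simp_all
  qed
  \<comment> \<open>Before one crossing time nothing arrives at \<open>X j\<close> from either side;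
    the two outgoing waves, 2 \<open>W j\<close> each, make up the jump.\<close>
  have gW: "g j t = 4 * W j t"
    if j: "j \<in> {1..<N}" and t: "t < T" "t < \<tau> + \<delta>" for j t
  proof -
    have j': "j \<in> {1..N}" "Suc j \<in> {1..N}" using j by auto
    have "r j j t = 0" "s (Suc j) j t = 0"
      using tr(1)[OF j'(1) t(1)] tr(2)[OF j'(2) t(1)] u0[OF j'(1), of "t - h j"]
        u0[OF j'(2), of "t - h (Suc j)"] \<delta>(1) \<delta>(2)[OF j'(1)] \<delta>(2)[OF j'(2)] t by auto
    with dir(1)[OF j'(2) t(1)] dir(2)[OF j'(1) t(1)] show ?thesis by (simp add: g_def)
  qed
  \<comment> \<open>The wave sent out in the Neumann step at time \<open>t - h j\<close> is the jump
    4 \<open>W\<close>, twice the Dirichlet one. At a physical end both are zero.\<close>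
  have in2: "p j j t = 2 * r j j t" "q j (j - 1) t = 2 * s j (j - 1) t"
    if j: "j \<in> {1..N}" and t: "t < T" "t < \<tau> + 2 * \<delta>" for j t
  proof -
    have t': "t - h j < T" "t - h j - h j < min T \<tau>" "t - h j < \<tau> + \<delta>"
      using t \<delta>(1) \<delta>(2)[OF j] by auto
    have q0: "q j (j - 1) (t - h j) = 0" "p j j (t - h j) = 0"
      using tr(3,4)[OF j t'(1)] \<phi>0[OF j t'(2)] by simp_all
    have "p j (j - 1) (t - h j) = 4 * W (j - 1) (t - h j)"
    proof (cases "j = 1")
      case True
      with bd(1)[OF t'(1)] bd(3)[OF t'(1)] q0 show ?thesis by simp
    next
      case False
      with j obtain m where "j = Suc m" "m \<in> {1..<N}" by (cases j) auto
      with neu(2)[of m "t - h j"] gW[of m "t - h j"] t' q0 show ?thesis by auto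
    qed
    with tr(3)[OF j t(1)] in1(1)[OF j t] show "p j j t = 2 * r j j t" by simp
    have "q j j (t - h j) = 4 * W j (t - h j)"
    proof (cases "j = N")
      case True
      with bd(2)[OF t'(1)] bd(4)[OF t'(1)] q0 show ?thesis by simp
    next
      case False
      with j neu(1)[of j "t - h j"] gW[of j "t - h j"] t' q0 show ?thesis by auto
    qed
    with tr(4)[OF j t(1)] in1(2)[OF j t] show "q j (j - 1) t = 2 * s j (j - 1) t" by simp
  qed
  have i': "i \<in> {1..N}" "Suc i \<in> {1..N}" using i by auto
  \<comment> \<open>The sum equals 2 p_i + 2 q_(i+1) + 2 g in the arriving waves. Here 2 p_i + 2
    q_(i+1) = 4 r_i + 4 s_(i+1), and g = 4 W - 2 r_i - 2 s_(i+1), so the arriving waves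
    cancel.\<close>
  show ?thesis
    using in2(1)[OF i'(1) t] in2(2)[OF i'(2) t] neu(1)[OF i t(1)] neu(2)[OF i t(1)]
      dir(2)[OF i'(1) t(1)] dir(1)[OF i'(2) t(1)]
    by (simp add: g_def)
qed

section \<open>One iteration of the algorithm\<close>

text \<open>Interface data carry no regularity assumption of their own; they inherit
  differentiability on (0,T) from the solution whose trace they are.\<close>

lemma boundary_value_DERIV:
  assumes u: "wave_solution c T a b u" and x: "x \<in> {a..b}" and t: "t \<in> {0<..<T}"
    and f: "\<And>t. t \<in> {0<..<T} \<Longrightarrow> u x t = f t"
  shows "(f has_real_derivative
     (riemann_invariant c T a b u x t + riemann_invariant (- c) T a b u x t) / 2) (at t)"
  using has_field_derivative_transform_within_open[OF wave_solution_time_DERIV[OF u x t] _ t, of f] f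
  by auto

text \<open>The network identity concerns time derivatives. It yields a zero derivative of the
  updated data, which is then integrated from the zero initial state.\<close>

lemma nnwr_step_vanishes:
  fixes X :: "nat \<Rightarrow> real"
  assumes c: "c > 0" and T: "T > 0" and N: "N \<ge> 2" and X: "\<And>i. i < N \<Longrightarrow> X i < X (i + 1)"
    and \<delta>: "\<delta> > 0" "\<And>i. i \<in> {1..N} \<Longrightarrow> \<delta> \<le> (X i - X (i - 1)) / c"
    and dir: "dirichlet_step c T N X w u" and neu: "neumann_step c T N X u \<phi>"
    and upd: "update_step T (1/4) N X w \<phi> w'"
    and bd: "\<And>t. t \<in> {0<..<T} \<Longrightarrow> w 0 t = 0" "\<And>t. t \<in> {0<..<T} \<Longrightarrow> w N t = 0"
    and w: "\<And>i t. i \<le> N \<Longrightarrow> t \<in> {0<..<T} \<Longrightarrow> t < \<tau> \<Longrightarrow> w i t = 0"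
    and i: "i \<in> {1..<N}" and t: "t \<in> {0<..<T}" "t < \<tau> + 2 * \<delta>"
  shows "w' i t = 0"
proof -
  define R where "R v j l t = riemann_invariant c T (X (j - 1)) (X j) (v j) (X l) t"
    for v j l t
  define S where "S v j l t = riemann_invariant (- c) T (X (j - 1)) (X j) (v j) (X l) t"
    for v j l t
  \<comment> \<open>The zero value for nonpositive times matches the extended invariants, so the
    Dirichlet relations hold for all \<open>t < T\<close>.\<close>
  define W where "W j t = (if t \<in> {0<..<T} then deriv (w j) t else 0)" for j t
  have less: "X (j - 1) < X j" if "j \<in> {1..N}" for j
    using X[of "j - 1"] that by auto
  have u: "wave_solution c T (X (j - 1)) (X j) (u j)"
    and \<phi>: "wave_solution c T (X (j - 1)) (X j) (\<phi> j)" if "j \<in> {1..N}" for j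
    using dir neu that unfolding dirichlet_step_def neumann_step_def by blast+
  have ul: "u j (X (j - 1)) t = w (j - 1) t" and ur: "u j (X j) t = w j t"
    if "j \<in> {1..N}" "t \<in> {0<..<T}" for j t
    using dir that unfolding dirichlet_step_def by blast+
  have init: "R v j l 0 = 0" "S v j l 0 = 0"
    if "wave_solution c T (X (j - 1)) (X j) (v j)" "j \<in> {1..N}" "l = j - 1 \<or> l = j" for v j l
    using wave_solution_initial(2)[OF that(1) less[OF that(2)] T, of "X l"] less[OF that(2)] that(3)
    unfolding R_def S_def by auto
  have neg: "R v j l t = 0" "S v j l t = 0" if "t < 0" for v j l t
    using that by (simp_all add: R_def S_def riemann_invariant_def)
  have W: "R u j (j - 1) t + S u j (j - 1) t = 2 * W (j - 1) t" "R u j j t + S u j j t = 2 * W j t"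
    if j: "j \<in> {1..N}" and t: "t < T" for j t
  proof -
    consider "t < 0" | "t = 0" | "t \<in> {0<..<T}" using t by force
    then have "R u j (j - 1) t + S u j (j - 1) t = 2 * W (j - 1) t \<and> R u j j t + S u j j t = 2 * W j t"
    proof cases
      case 3
      have "(w (j - 1) has_real_derivative (R u j (j - 1) t + S u j (j - 1) t) / 2) (at t)"
        unfolding R_def S_def
        by (rule boundary_value_DERIV[OF u[OF j] _ 3 ul[OF j]]) (use less[OF j] in simp)
      moreover have "(w j has_real_derivative (R u j j t + S u j j t) / 2) (at t)"
        unfolding R_def S_def
        by (rule boundary_value_DERIV[OF u[OF j] _ 3 ur[OF j]]) (use less[OF j] in simp)
      ultimately show ?thesis using 3 by (simp add: W_def DERIV_imp_deriv)
    qed (simp_all add: W_def neg init[where v = u, OF u[OF j] j])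
    then show "R u j (j - 1) t + S u j (j - 1) t = 2 * W (j - 1) t" "R u j j t + S u j j t = 2 * W j t"
      by simp_all
  qed
  have W0: "W j t = 0" if "j \<le> N" "t < T" "\<And>r. r \<in> {0<..<T} \<Longrightarrow> r < t' \<Longrightarrow> w j r = 0" "t < t'" for j t t'
  proof (cases "t > 0")
    case True
    have "(w j has_real_derivative 0) (at t)"
      by (rule has_field_derivative_transform_within_open[where f = "\<lambda>_. 0" and S = "{0<..<min T t'}"])
         (use True that in auto)
    then show ?thesis by (simp add: W_def DERIV_imp_deriv)
  qed (simp add: W_def)
  have diff: "S v j l t - R v j l t = 2 * c * flux X v j l t" if "0 \<le> t" for v j l t
    using riemann_invariant_diff[OF that] by (simp add: R_def S_def flux_def)
  \<comment> \<open>All flux conditions carry the same factor \<open>2 * c\<close>, so they become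
    relations between invariants; for nonpositive times every term is zero.\<close>
  have neuR: "S \<phi> j j t - R \<phi> j j t = (S u j j t - R u j j t) - (S u (Suc j) j t - R u (Suc j) j t)"
    and neuL: "R \<phi> (Suc j) j t - S \<phi> (Suc j) j t =
      (S u j j t - R u j j t) - (S u (Suc j) j t - R u (Suc j) j t)"
    if j: "j \<in> {1..<N}" and t: "t < T" for j t
  proof -
    have j': "j \<in> {1..N}" "Suc j \<in> {1..N}" using j by auto
    consider "t < 0" | "t = 0" | "t \<in> {0<..<T}" using t by force
    then have "S \<phi> j j t - R \<phi> j j t = (S u j j t - R u j j t) - (S u (Suc j) j t - R u (Suc j) j t) \<and>
      R \<phi> (Suc j) j t - S \<phi> (Suc j) j t = (S u j j t - R u j j t) - (S u (Suc j) j t - R u (Suc j) j t)"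
    proof cases
      case 3
      then have t0: "0 \<le> t" by simp
      have "flux X \<phi> j j t = flux X u j j t - flux X u (Suc j) j t"
        using neu[unfolded neumann_step_def, THEN bspec, OF j'(1)] j 3 by simp
      moreover have "- flux X \<phi> (Suc j) j t = flux X u j j t - flux X u (Suc j) j t"
        using neu[unfolded neumann_step_def, THEN bspec, OF j'(2)] j 3 by simp
      moreover have "(S u j j t - R u j j t) - (S u (Suc j) j t - R u (Suc j) j t) =
          2 * c * (flux X u j j t - flux X u (Suc j) j t)"
        unfolding diff[OF t0] by (simp only: right_diff_distrib)
      moreover have "R \<phi> (Suc j) j t - S \<phi> (Suc j) j t = 2 * c * (- flux X \<phi> (Suc j) j t)"
        using diff[OF t0, of \<phi> "Suc j" j] by simp
      ultimately show ?thesis using diff[OF t0, of \<phi> j j] by metis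
    qed (use init[where v = u, OF u[OF j'(1)] j'(1)] init[where v = u, OF u[OF j'(2)] j'(2)]
          init[where v = \<phi>, OF \<phi>[OF j'(1)] j'(1)] init[where v = \<phi>, OF \<phi>[OF j'(2)] j'(2)]
          in \<open>simp_all add: neg\<close>)
    then show "S \<phi> j j t - R \<phi> j j t = (S u j j t - R u j j t) - (S u (Suc j) j t - R u (Suc j) j t)"
      "R \<phi> (Suc j) j t - S \<phi> (Suc j) j t =
        (S u j j t - R u j j t) - (S u (Suc j) j t - R u (Suc j) j t)"
      by simp_all
  qed
  have dirichlet0: "R \<phi> j l t + S \<phi> j l t = 0"
    if j: "j \<in> {1..N}" "l = j - 1 \<or> l = j" and t: "t < T"
      and z: "\<And>t. t \<in> {0<..<T} \<Longrightarrow> \<phi> j (X l) t = 0" for j l t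
  proof -
    consider "t < 0" | "t = 0" | "t \<in> {0<..<T}" using t by force
    then show ?thesis
    proof cases
      case 3
      have "((\<lambda>_. 0) has_real_derivative (R \<phi> j l t + S \<phi> j l t) / 2) (at t)"
        unfolding R_def S_def
        by (rule boundary_value_DERIV[OF \<phi>[OF j(1)] _ 3 z]) (use less[OF j(1)] j(2) in auto)
      then show ?thesis using DERIV_unique[OF _ DERIV_const[of 0]] by fastforce
    qed (use init[where v = \<phi>, OF \<phi>[OF j(1)] j] in \<open>simp_all add: neg\<close>)
  qed
  have \<phi>bd: "\<phi> 1 (X 0) t = 0" "\<phi> N (X N) t = 0" if "t \<in> {0<..<T}" for t
    using neu[unfolded neumann_step_def, THEN bspec, of 1]
      neu[unfolded neumann_step_def, THEN bspec, of N] N that by simp_all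
  have sum: "(R \<phi> i i t + S \<phi> i i t) + (R \<phi> (Suc i) i t + S \<phi> (Suc i) i t) = 8 * W i t"
    if "t < T" "t < \<tau> + 2 * \<delta>" for t
  proof (rule characteristic_network_step[where r = "R u" and s = "S u"
        and p = "R \<phi>" and q = "S \<phi>" and W = W and i = i and T = T and \<tau> = \<tau>
        and N = N and \<delta> = \<delta> and h = "\<lambda>j. (X j - X (j - 1)) / c"])
    fix j t assume "j \<in> {1..N}" "t < T"
    then show "R u j j t = R u j (j - 1) (t - (X j - X (j - 1)) / c)"
      "S u j (j - 1) t = S u j j (t - (X j - X (j - 1)) / c)"
      "R \<phi> j j t = R \<phi> j (j - 1) (t - (X j - X (j - 1)) / c)"
      "S \<phi> j (j - 1) t = S \<phi> j j (t - (X j - X (j - 1)) / c)"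
      unfolding R_def S_def using riemann_invariant_traverse[OF u c less]
        riemann_invariant_traverse[OF \<phi> c less] by blast+
  next
    fix t assume t: "t < T"
    show "R \<phi> 1 0 t + S \<phi> 1 0 t = 0" "R \<phi> N N t + S \<phi> N N t = 0"
      using t N \<phi>bd by (auto intro!: dirichlet0)
    show "W 0 t = 0" "W N t = 0"
      using t bd by (auto intro!: W0[where t' = T])
  next
    show "W j t = 0" if "j \<le> N" "t < T" "t < \<tau>" for j t
      using that w by (auto intro!: W0[where t' = \<tau>])
  qed (use \<delta> neg W neuR neuL i that in auto)
  have i': "i \<in> {1..N}" "Suc i \<in> {1..N}" using i by auto
  \<comment> \<open>The update is written with the trace of \<open>u i\<close> instead of
    \<open>w i\<close>: the trace is continuous down to time 0, where \<open>w i\<close> is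
    unconstrained.\<close>
  let ?f = "\<lambda>t. u i (X i) t - 1/4 * (\<phi> i (X i) t + \<phi> (Suc i) (X i) t)"
  have mem: "X i \<in> {X (i - 1)..X i}" "X i \<in> {X (Suc i - 1)..X (Suc i)}"
    using less[OF i'(1)] less[OF i'(2)] by auto
  have "?f t = ?f 0"
  proof (rule DERIV_isconst_end[where f = ?f])
    show "0 < t" using t by simp
    show "continuous_on {0..t} ?f"
      using wave_solution_time_continuous[OF u[OF i'(1)] mem(1)]
        wave_solution_time_continuous[OF \<phi>[OF i'(1)] mem(1)]
        wave_solution_time_continuous[OF \<phi>[OF i'(2)] mem(2)] t
      by (intro continuous_intros) (auto elim: continuous_on_subset)
    fix r assume r: "0 < r" "r < t"
    then have r': "r \<in> {0<..<T}" "r < T" "r < \<tau> + 2 * \<delta>" using t by auto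
    have "(?f has_real_derivative (R u i i r + S u i i r) / 2 -
        1/4 * ((R \<phi> i i r + S \<phi> i i r) / 2 + (R \<phi> (Suc i) i r + S \<phi> (Suc i) i r) / 2)) (at r)"
      unfolding R_def S_def
      by (intro DERIV_diff DERIV_cmult DERIV_add wave_solution_time_DERIV[OF u[OF i'(1)] mem(1) r'(1)]
          wave_solution_time_DERIV[OF \<phi>[OF i'(1)] mem(1) r'(1)]
          wave_solution_time_DERIV[OF \<phi>[OF i'(2)] mem(2) r'(1)])
    moreover have "(R u i i r + S u i i r) / 2 -
        1/4 * ((R \<phi> i i r + S \<phi> i i r) / 2 + (R \<phi> (Suc i) i r + S \<phi> (Suc i) i r) / 2) = 0"
      using sum[OF r'(2,3)] W(2)[OF i'(1) r'(2)] by (simp add: field_simps)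
    ultimately show "(?f has_real_derivative 0) (at r)" by metis
  qed
  also have "\<dots> = 0"
    using wave_solution_initial(1)[OF u[OF i'(1)] less[OF i'(1)] T mem(1)]
      wave_solution_initial(1)[OF \<phi>[OF i'(1)] less[OF i'(1)] T mem(1)]
      wave_solution_initial(1)[OF \<phi>[OF i'(2)] less[OF i'(2)] T mem(2)] by simp
  finally have "?f t = 0" .
  moreover have "w' i t = w i t - 1/4 * (\<phi> i (X i) t + \<phi> (i + 1) (X i) t)"
    using upd i t unfolding update_step_def by auto
  ultimately show ?thesis using ur[OF i'(1) t(1)] by simp
qed

section \<open>Uniqueness for the Dirichlet problem and convergence\<close>

text \<open>Zero boundary data reflect waves with a change of sign, so the invariants vanish on the
  lateral boundary. Transport makes them vanish inside, and \<open>u x\<close> stays at its initial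
  value 0.\<close>

lemma wave_solution_zero_dirichlet:
  assumes u: "wave_solution c T a b u" and c: "c > 0" and ab: "a < b"
    and bd: "\<And>t. t \<in> {0<..<T} \<Longrightarrow> u a t = 0 \<and> u b t = 0"
    and x: "x \<in> {a..b}" and t: "t \<in> {0<..<T}"
  shows "u x t = 0"
proof -
  have T: "0 < T" using t by auto
  let ?R = "riemann_invariant c T a b u" and ?S = "riemann_invariant (- c) T a b u"
  have sum0: "?R y t + ?S y t = 0" if y: "y = a \<or> y = b" and t: "t < T" for y t
  proof -
    consider "t < 0" | "t = 0" | "t \<in> {0<..<T}" using t by force
    then show ?thesis
    proof cases
      case 1
      then show ?thesis by (simp add: riemann_invariant_def)
    next
      case 2
      then show ?thesis using wave_solution_initial(2)[OF u ab T, of y] y ab by auto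
    next
      case 3
      have "((\<lambda>_. 0) has_real_derivative (?R y t + ?S y t) / 2) (at t)"
        by (rule boundary_value_DERIV[OF u _ 3]) (use bd y ab in auto)
      then show ?thesis using DERIV_unique[OF _ DERIV_const[of 0]] by fastforce
    qed
  qed
  have neg: "?R y t = 0" "?S y t = 0" if "t < 0" for y t
    using that by (simp_all add: riemann_invariant_def)
  have h: "(b - a) / c > 0" using c ab by simp
  have refl_abs: "\<bar>?R y t\<bar> = \<bar>?S y t\<bar>" if "y = a \<or> y = b" "t < T" for y t
    using sum0[OF that] by linarith
  have edge: "?R a t = 0" "?S b t = 0" if "t < T" for t
    using reflecting_traces_zero(1,4)[where rl = "?R a" and rr = "?R b" and sl = "?S a"
        and sr = "?S b" and \<tau> = T, OF h riemann_invariant_traverse[OF u c ab]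
        refl_abs[OF disjI1[OF refl]] refl_abs[OF disjI2[OF refl]] neg that]
    by simp_all
  have delay: "t - y / c < T" if "t < T" "0 \<le> y" for t y
    using that c divide_nonneg_pos[of y c] by linarith
  have inner: "?R x t = 0" "?S x t = 0" if t: "t < T" for t
  proof -
    \<comment> \<open>The first argument is \<open>x\<close>, written as the point reached from
      \<open>a\<close> after the travel time \<open>(x - a) / c\<close>.\<close>
    have "?R (a + c * ((x - a) / c)) t = ?R a (t - (x - a) / c)"
      by (rule riemann_invariant_transport[OF u refl _ ab]) (use c ab x t in auto)
    with edge(1)[OF delay[OF t]] c x show "?R x t = 0" by simp
    have "?S (b + - c * ((b - x) / c)) t = ?S b (t - (b - x) / c)"
      by (rule riemann_invariant_transport[OF u _ _ ab]) (use c ab x t in auto)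
    with edge(2)[OF delay[OF t]] c x show "?S x t = 0" by simp
  qed
  have "u x t = u x 0"
  proof (rule DERIV_isconst_end[where f = "u x"])
    show "0 < t" using t by simp
    show "continuous_on {0..t} (u x)"
      using wave_solution_time_continuous[OF u x] t by (auto elim: continuous_on_subset)
    fix r assume "0 < r" "r < t"
    then show "(u x has_real_derivative 0) (at r)"
      using wave_solution_time_DERIV[OF u x, of r c] inner[of r] t by simp
  qed
  with wave_solution_initial(1)[OF u ab T x] show ?thesis by simp
qed

theorem theorem2p1:
  fixes c L T :: real and N k :: nat and X :: "nat \<Rightarrow> real"
    and w :: "nat \<Rightarrow> nat \<Rightarrow> real \<Rightarrow> real"
    and u \<phi> :: "nat \<Rightarrow> nat \<Rightarrow> real \<Rightarrow> real \<Rightarrow> real"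
  assumes "c > 0" and "L > 0" and "N \<ge> 2"
    and "X 0 = 0" and "X N = L" and "\<And>i. i < N \<Longrightarrow> X i < X (i + 1)"
    and "k \<ge> 1" and "T > 0" and "T / real k \<le> 2 * h_min N X / c"
    and "nnwr_run c T (1/4) N X w u \<phi>"
  shows "converges_in (k + 1) T N X u"
proof -
  note c = \<open>c > 0\<close> and N = \<open>N \<ge> 2\<close> and X = \<open>\<And>i. i < N \<Longrightarrow> X i < X (i + 1)\<close>
    and run = \<open>nnwr_run c T (1/4) N X w u \<phi>\<close>
  define \<delta> where "\<delta> = h_min N X / c"
  have less: "X (i - 1) < X i" if "i \<in> {1..N}" for i
    using X[of "i - 1"] that by auto
  have "h_min N X > 0" "\<And>i. i \<in> {1..N} \<Longrightarrow> h_min N X \<le> X i - X (i - 1)"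
    using less N by (auto simp: h_min_def)
  with c have \<delta>: "\<delta> > 0" "\<And>i. i \<in> {1..N} \<Longrightarrow> \<delta> \<le> (X i - X (i - 1)) / c"
    by (auto simp: \<delta>_def divide_right_mono)
  have bd: "w m 0 t = 0" "w m N t = 0" if "t \<in> {0<..<T}" for m t
    using run that unfolding nnwr_run_def by blast+
  have steps: "dirichlet_step c T N X (w m) (u (Suc m))" "neumann_step c T N X (u (Suc m)) (\<phi> (Suc m))"
    "update_step T (1/4) N X (w m) (\<phi> (Suc m)) (w (Suc m))" for m
    using run[unfolded nnwr_run_def, THEN conjunct2, rule_format, of "Suc m"] by simp_all
  \<comment> \<open>Each update extends the silent window by \<open>2 * \<delta>\<close>, where
    \<open>\<delta>\<close> is the shortest crossing time.\<close>
  have vanish: "w m i t = 0" if "i \<le> N" "t \<in> {0<..<T}" "t < real m * (2 * \<delta>)" for m i t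
    using that
  proof (induction m arbitrary: i t)
    case 0
    then show ?case by simp
  next
    case (Suc m)
    consider "i = 0" | "i = N" | "i \<in> {1..<N}" using Suc.prems(1) by fastforce
    then show ?case
    proof cases
      case 3
      have "t < real m * (2 * \<delta>) + 2 * \<delta>"
        using Suc.prems(3) by (simp add: algebra_simps)
      with 3 Suc.prems(2) show ?thesis
        by (intro nnwr_step_vanishes[OF c \<open>T > 0\<close> N X \<delta> steps bd Suc.IH])
    qed (use bd Suc.prems in auto)
  qed
  \<comment> \<open>After \<open>k\<close> updates the silent window covers (0,T), so the Dirichlet
    solve of iteration \<open>k + 1\<close> has zero boundary data.\<close>
  have "T \<le> real k * (2 * \<delta>)"
    using \<open>T / real k \<le> 2 * h_min N X / c\<close> \<open>k \<ge> 1\<close> by (simp add: \<delta>_def field_simps)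
  with vanish have w0: "w k i t = 0" if "i \<le> N" "t \<in> {0<..<T}" for i t
    using that by auto
  show ?thesis
    unfolding converges_in_def
  proof (intro ballI)
    fix i x t assume i: "i \<in> {1..N}" and x: "x \<in> {X (i - 1)<..<X i}" and t: "t \<in> {0<..<T}"
    have "wave_solution c T (X (i - 1)) (X i) (u (Suc k) i)"
      and "\<And>t. t \<in> {0<..<T} \<Longrightarrow> u (Suc k) i (X (i - 1)) t = 0 \<and> u (Suc k) i (X i) t = 0"
      using steps(1)[of k] i w0[of i] w0[of "i - 1"] unfolding dirichlet_step_def by auto
    then show "u (k + 1) i x t = 0"
      using wave_solution_zero_dirichlet[OF _ c less[OF i] _ _ t, of "u (Suc k) i" x] x by auto
  qed
qed

end
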